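(* The sequence $\log n$ is a C-multiplier for any rearrangement of a generalized Haar system; that is, if $\{\chi_n\}_{n\ge1}$ is a generalized Haar system and $\sigma:\mathbb N\to\mathbb N$ is a bijection, then for all real coefficients $a_n$ with $\sum_{n=1}^\infty a_n^2\log n<\infty$ the series $\sum_{n=1}^\infty a_n\chi_{\sigma(n)}(x)$ converges almost everywhere on $[0,1)$.
   Context: Functions are real-valued, on $[0,1)$ with Lebesgue measure; $\log$ has base $2$. A partition of $[0,1)$ is a sequence of pairwise disjoint measurable sets with union $[0,1)$. A filtration is a sequence $\mathcal A_n$, $n=1,2,\ldots$, of partitions of $[0,1)$ such that every $A\in\mathcal A_n$ is a union of some sets from $\mathcal A_{n+1}$ (called children of $A$). A martingale difference based on a filtration $\{\mathcal A_n\}$ is a sequence of functions $f_n\in L^1(0,1)$, $n=1,2,\ldots$, such that (1) $f_n$ is constant on each $A\in\mathcal A_n$; (2) $\int_A f_n=0$ for every $A\in\mathcal A_{n-1}$, $n\ge2$. A generalized Haar system is an $L^2$-normalized ($\|f_n\|_2=1$) martingale difference based on a filtration $\{\mathcal A_n\}$ such that: $\mathcal A_1=\{[0,1)\}$; for each $n\ge1$, $\mathcal A_{n+1}$ is obtained from $\mathcal A_n$ by splitting exactly one interval $[\alpha,\beta)\in\mathcal A_n$ into two intervals $[\alpha,\gamma)$, $[\gamma,\beta)$ with $\alpha<\gamma<\beta$ (all other intervals being kept); and $\max_{A\in\mathcal A_n}|A|\to0$ as $n\to\infty$. A sequence $\omega(n)\nearrow\infty$ is an a.e. convergence Weyl multiplier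 (C-multiplier) for an orthonormal system $\{\phi_n\}$ if every series $\sum_{n=1}^\infty a_n\phi_n(x)$ with $\sum_{n=1}^\infty a_n^2\,\omega(n)<\infty$ converges a.e. (The value $\log1=0$ at $n=1$ is immaterial for this.) *)

theory Defs
  imports "HOL-Analysis.Analysis"
begin

text \<open>All sequences are indexed by \<open>n = 1, 2, \<dots>\<close>; they are modelled as functions on
  \<^typ>\<open>nat\<close> whose value at \<open>0\<close> is never used.\<close>

abbreviation unit_leb :: "real measure"
  where "unit_leb \<equiv> lebesgue_on {0..<1}"

text \<open>The members of a partition are collected in a countable set rather than listed.\<close>

definition unit_partition :: "real set set \<Rightarrow> bool"
  where "unit_partition P \<longleftrightarrow>
    countable P \<and> P \<subseteq> sets unit_leb \<and> disjoint P \<and> \<Union>P = {0..<1}"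

definition unit_filtration :: "(nat \<Rightarrow> real set set) \<Rightarrow> bool"
  where "unit_filtration \<A> \<longleftrightarrow>
    (\<forall>n\<ge>1. unit_partition (\<A> n)) \<and>
    (\<forall>n\<ge>1. \<forall>A\<in>\<A> n. \<exists>\<C>\<subseteq>\<A> (n + 1). A = \<Union>\<C>)"

definition martingale_difference :: "(nat \<Rightarrow> real set set) \<Rightarrow> (nat \<Rightarrow> real \<Rightarrow> real) \<Rightarrow> bool"
  where "martingale_difference \<A> f \<longleftrightarrow>
    unit_filtration \<A> \<and>
    (\<forall>n\<ge>1. integrable unit_leb (f n)) \<and>
    (\<forall>n\<ge>1. \<forall>A\<in>\<A> n. f n constant_on A) \<and>
    (\<forall>n\<ge>2. \<forall>A\<in>\<A> (n - 1). (LINT x:A|unit_leb. f n x) = 0)"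

text \<open>The Bochner integral of a non-integrable function is \<open>0\<close>, so \<open>L2_norm_unit f = 1\<close>
  entails that the square of \<open>f\<close> is integrable.\<close>

definition L2_norm_unit :: "(real \<Rightarrow> real) \<Rightarrow> real"
  where "L2_norm_unit f = sqrt (LINT x|unit_leb. (f x)\<^sup>2)"

definition splits_one_interval :: "real set set \<Rightarrow> real set set \<Rightarrow> bool"
  where "splits_one_interval P Q \<longleftrightarrow>
    (\<exists>\<alpha> \<gamma> \<beta>. \<alpha> < \<gamma> \<and> \<gamma> < \<beta> \<and> {\<alpha>..<\<beta>} \<in> P \<and>
       Q = (P - {{\<alpha>..<\<beta>}}) \<union> {{\<alpha>..<\<gamma>}, {\<gamma>..<\<beta>}})"

text \<open>For \<open>n \<ge> 1\<close> the partition \<open>\<A> n\<close> below is finite (it has \<open>n\<close> members), so that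
  \<^const>\<open>Max\<close> is a genuine maximum.\<close>

definition generalized_Haar_system :: "(nat \<Rightarrow> real \<Rightarrow> real) \<Rightarrow> bool"
  where "generalized_Haar_system h \<longleftrightarrow>
    (\<exists>\<A>. martingale_difference \<A> h \<and>
       (\<forall>n\<ge>1. L2_norm_unit (h n) = 1) \<and>
       \<A> 1 = {{0..<1}} \<and>
       (\<forall>n\<ge>1. splits_one_interval (\<A> n) (\<A> (n + 1))) \<and>
       (\<lambda>n. Max (measure unit_leb ` \<A> n)) \<longlonglongrightarrow> 0)"

definition orthonormal_system :: "(nat \<Rightarrow> real \<Rightarrow> real) \<Rightarrow> bool"
  where "orthonormal_system \<phi> \<longleftrightarrow>
    (\<forall>n\<ge>1. \<phi> n \<in> borel_measurable unit_leb) \<and>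
    (\<forall>m\<ge>1. \<forall>n\<ge>1. (LINT x|unit_leb. \<phi> m x * \<phi> n x) = (if m = n then 1 else 0))"

text \<open>The standing requirements, that \<open>\<omega>\<close> increases to infinity and that \<open>\<phi>\<close> is orthonormal,
  are part of the definition. The shift by \<^const>\<open>Suc\<close> makes the series start at index \<open>1\<close>.\<close>

definition C_multiplier :: "(nat \<Rightarrow> real) \<Rightarrow> (nat \<Rightarrow> real \<Rightarrow> real) \<Rightarrow> bool"
  where "C_multiplier \<omega> \<phi> \<longleftrightarrow>
    mono_on {1..} \<omega> \<and> filterlim \<omega> at_top sequentially \<and> orthonormal_system \<phi> \<and>
    (\<forall>a :: nat \<Rightarrow> real. summable (\<lambda>n. (a (Suc n))\<^sup>2 * \<omega> (Suc n)) \<longrightarrow>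
       (AE x in unit_leb. summable (\<lambda>n. a (Suc n) * \<phi> (Suc n) x)))"

end

theory Submission
  imports Defs "HOL-Probability.Probability_Measure" "HOL-Real_Asymp.Real_Asymp"
begin

text \<open>
  For a finite linear combination \<open>F = \<Sum> b\<^sub>n h\<^sub>n\<close> of mean-zero Haar functions with supports \<open>I\<^sub>n\<close>, let
  \<open>V = \<Sum> b\<^sub>n\<^sup>2 (h\<^sub>n\<^sup>2 + 1\<^bsub>I\<^sub>n\<^esub> / \<bar>I\<^sub>n\<bar>)\<close> be the sum of its quadratic and conditional quadratic
  variations. Because \<open>exp (x - x\<^sup>2) \<le> 1 + x + x\<^sup>2\<close>, integrating out the functions from the last to
  the first gives \<open>\<integral> exp (t F - t\<^sup>2 V) \<le> 1\<close>, hence the self-normalized tail bound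
  \<open>\<bar>{\<bar>F\<bar> \<ge> l, V \<le> y}\<bar> \<le> 2 exp (- l\<^sup>2 / (4 y))\<close>, which needs no regularity of the filtration and is
  insensitive to the order of summation. Cut the rearranged series into the blocks
  \<open>2\<^bsup>2^k\<^esup> \<le> n < 2\<^bsup>2^(k+1)\<^esup>\<close>. As \<open>\<Sum> 2\<^sup>k \<integral> V\<^sub>k \<le> 2 \<Sum> a\<^sub>n\<^sup>2 log n < \<infinity>\<close>, the block variations satisfy
  \<open>2\<^sup>k V\<^sub>k \<rightarrow> 0\<close> almost everywhere. The tail bound beats the number of partial sums in the block on
  the set \<open>2\<^sup>k V\<^sub>k \<le> e\<^sup>2 / 12\<close>, so by Borel--Cantelli the oscillation inside the blocks tends to
  \<open>0\<close>. The complete block sums \<open>D\<^sub>k\<close> converge absolutely since \<open>\<Sum> 2\<^sup>k D\<^sub>k\<^sup>2 < \<infinity>\<close> almost everywhere.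
\<close>

section \<open>An exponential inequality and summation by blocks\<close>

text \<open>From exp (-z) >= 1 - z with z = x - x^2 one gets exp (x - x^2) * (1 - x + x^2) <= 1. On
  the other side (1 + x + x^2) * (1 - x + x^2) = 1 + x^2 + x^4 >= 1, and the common factor 1 - x +
  x^2 is positive.\<close>

lemma exp_diff_square_le:
  fixes x :: real
  shows "exp (x - x\<^sup>2) \<le> 1 + x + x\<^sup>2"
proof -
  have "1 - x + x\<^sup>2 = (x - 1/2)\<^sup>2 + 3/4"
    by (simp add: power2_eq_square algebra_simps)
  then have pos: "1 - x + x\<^sup>2 > 0"
    using zero_le_power2[of "x - 1/2"] by linarith
  have "1 - x + x\<^sup>2 \<le> exp (- (x - x\<^sup>2))"
    using exp_ge_add_one_self[of "- (x - x\<^sup>2)"] by (simp add: algebra_simps)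
  then have "exp (x - x\<^sup>2) * (1 - x + x\<^sup>2) \<le> exp (x - x\<^sup>2) * exp (- (x - x\<^sup>2))"
    by (intro mult_left_mono) auto
  also have "\<dots> = 1" by (simp flip: exp_add)
  also have "1 \<le> (1 + x + x\<^sup>2) * (1 - x + x\<^sup>2)"
  proof -
    have "(1 + x + x\<^sup>2) * (1 - x + x\<^sup>2) = 1 + x\<^sup>2 + x\<^sup>2 * x\<^sup>2"
      by (simp add: algebra_simps power2_eq_square)
    then show ?thesis by simp
  qed
  finally show ?thesis using pos by (simp add: mult_le_cancel_right)
qed

lemma AE_summable_of_summable_integral:
  fixes f :: "nat \<Rightarrow> 'a \<Rightarrow> real"
  assumes int: "\<And>k. integrable M (f k)" and nonneg: "\<And>k x. 0 \<le> f k x"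
    and sum: "summable (\<lambda>k. integral\<^sup>L M (f k))"
  shows "AE x in M. summable (\<lambda>k. f k x)"
proof -
  have [measurable]: "f k \<in> borel_measurable M" for k
    using int by auto
  have "(\<integral>\<^sup>+x. (\<Sum>k. ennreal (f k x)) \<partial>M) = (\<Sum>k. \<integral>\<^sup>+x. ennreal (f k x) \<partial>M)"
    by (rule nn_integral_suminf) auto
  also have "\<dots> = (\<Sum>k. ennreal (integral\<^sup>L M (f k)))"
    by (intro suminf_cong nn_integral_eq_integral int) (auto simp: nonneg)
  also have "\<dots> = ennreal (\<Sum>k. integral\<^sup>L M (f k))"
    by (intro suminf_ennreal2 sum) (auto simp: nonneg)
  finally have "AE x in M. (\<Sum>k. ennreal (f k x)) \<noteq> \<infinity>"
    by (intro nn_integral_PInf_AE) auto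
  then show ?thesis
    by eventually_elim (auto intro!: summable_suminf_not_top simp: nonneg)
qed

text \<open>The block containing \<open>n\<close> is found by taking the last \<open>k\<close> with
  \<open>N k\<close> at most \<open>n\<close>; it exists because k <= N k bounds all candidates by
  \<open>n\<close>.\<close>

lemma strict_mono_bracket:
  fixes N :: "nat \<Rightarrow> nat"
  assumes "strict_mono N" and "N K \<le> n"
  obtains k where "K \<le> k" "N k \<le> n" "n < N (Suc k)"
proof -
  let ?P = "\<lambda>k. N k \<le> n"
  have bd: "k \<le> n" if "?P k" for k
    using that strict_mono_imp_increasing[OF assms(1), of k] by linarith
  define k where "k = Greatest ?P"
  have "?P k" unfolding k_def by (rule GreatestI_nat[of ?P K n]) (use assms bd in auto)
  moreover have "K \<le> k" unfolding k_def by (rule Greatest_le_nat[of ?P K n]) (use assms bd in auto)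
  moreover have "n < N (Suc k)"
    unfolding not_le[symmetric]
    using Greatest_le_nat[of ?P "Suc k" n] bd Suc_n_not_le_n unfolding k_def[symmetric] by blast
  ultimately show ?thesis by (intro that)
qed

text \<open>The partial sums at block starts converge by \<open>blocks\<close>, and any later
  partial sum differs from that at the start of its block by an inner sum. Terms before
  \<open>N 0\<close> only shift the limit.\<close>

lemma summable_of_blocks:
  fixes c :: "nat \<Rightarrow> real"
  assumes N: "strict_mono N"
    and blocks: "summable (\<lambda>k. \<Sum>n = N k..<N (Suc k). c n)"
    and inner: "\<And>e. 0 < e \<Longrightarrow> \<forall>\<^sub>F k in sequentially. \<forall>m\<in>{N k..<N (Suc k)}. \<bar>\<Sum>n = N k..<m. c n\<bar> \<le> e"
  shows "summable c"
proof -
  define s where "s n = (\<Sum>i<n. c i)" for n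
  have split: "s n = s m + (\<Sum>i=m..<n. c i)" if "m \<le> n" for m n
    unfolding s_def lessThan_atLeast0 using that by (simp add: sum.atLeastLessThan_concat)
  have eq: "s (N k) = s (N 0) + (\<Sum>j<k. \<Sum>n = N j..<N (Suc j). c n)" for k
  proof (induction k)
    case (Suc k)
    have "N k \<le> N (Suc k)" using N by (simp add: strict_mono_less_eq)
    from split[OF this] Suc show ?case by simp
  qed simp
  obtain l where l: "(\<lambda>k. \<Sum>j<k. \<Sum>n = N j..<N (Suc j). c n) \<longlonglongrightarrow> l"
    using blocks unfolding summable_def sums_def by blast
  have lim: "(\<lambda>k. s (N k)) \<longlonglongrightarrow> s (N 0) + l"
    by (subst eq) (intro tendsto_add tendsto_const l)
  have "s \<longlonglongrightarrow> s (N 0) + l"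
  proof (rule metric_LIMSEQ_I)
    fix e :: real assume e: "0 < e"
    from lim e have "\<forall>\<^sub>F k in sequentially. dist (s (N k)) (s (N 0) + l) < e/2"
      by (intro tendstoD) auto
    with inner[of "e/2"] e
    have "\<forall>\<^sub>F k in sequentially. dist (s (N k)) (s (N 0) + l) < e/2 \<and>
        (\<forall>m\<in>{N k..<N (Suc k)}. \<bar>\<Sum>n = N k..<m. c n\<bar> \<le> e/2)"
      by (simp add: eventually_conj_iff)
    then obtain K where K: "\<And>k. k \<ge> K \<Longrightarrow> dist (s (N k)) (s (N 0) + l) < e/2 \<and>
        (\<forall>m\<in>{N k..<N (Suc k)}. \<bar>\<Sum>n = N k..<m. c n\<bar> \<le> e/2)"
      unfolding eventually_sequentially by blast
    have "dist (s n) (s (N 0) + l) < e" if "n \<ge> N K" for n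
    proof -
      obtain k where k: "K \<le> k" "N k \<le> n" "n < N (Suc k)"
        using strict_mono_bracket[OF N \<open>n \<ge> N K\<close>] .
      have "\<bar>\<Sum>i=N k..<n. c i\<bar> \<le> e/2" using K[OF k(1)] k by auto
      then have "dist (s n) (s (N k)) \<le> e/2"
        using split[OF k(2)] by (simp add: dist_real_def)
      with K[OF k(1)] show ?thesis
        using dist_triangle[of "s n" "s (N 0) + l" "s (N k)"] by linarith
    qed
    then show "\<exists>no. \<forall>n\<ge>no. dist (s n) (s (N 0) + l) < e" by blast
  qed
  then show ?thesis unfolding s_def summable_def sums_def by blast
qed

text \<open>The norm is only bounded by \<open>1\<close>, so that the constant first Haar function, which does not have
  mean zero, may be replaced by \<open>0\<close>.\<close>

locale nested_differences = prob_space M for M :: "'a measure" +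
  fixes g :: "nat \<Rightarrow> 'a \<Rightarrow> real" and I :: "nat \<Rightarrow> 'a set"
  assumes I_sets [measurable]: "I n \<in> sets M"
    and I_pos: "0 < measure M (I n)"
    and g_integrable: "integrable M (g n)"
    and g_sq_integrable: "integrable M (\<lambda>x. (g n x)\<^sup>2)"
    and g_zero: "x \<in> space M \<Longrightarrow> x \<notin> I n \<Longrightarrow> g n x = 0"
    and g_mean: "integral\<^sup>L M (g n) = 0"
    and g_norm: "(LINT x|M. (g n x)\<^sup>2) \<le> 1"
    and g_const: "m < n \<Longrightarrow> x \<in> I n \<Longrightarrow> y \<in> I n \<Longrightarrow> g m x = g m y"
    and I_nested: "m < n \<Longrightarrow> x \<in> I n \<Longrightarrow> y \<in> I n \<Longrightarrow> x \<in> I m \<longleftrightarrow> y \<in> I m"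
begin

section \<open>Variation weights, orthogonality and mean-square bounds\<close>

lemma g_measurable [measurable]: "g n \<in> borel_measurable M"
  using g_integrable by auto

lemma indicator_I_integrable: "integrable M (indicat_real (I n))"
  by (rule integrable_real_indicator) (auto simp: less_top[symmetric])

text \<open>The second summand dominates the mean of (g n)^2 over \<open>I n\<close>, by
  \<open>g_norm\<close>. It depends only on the support, and its exponential will absorb the second
  moment left over when \<open>g n\<close> is integrated out.\<close>

definition w :: "nat \<Rightarrow> 'a \<Rightarrow> real"
  where "w n x = (g n x)\<^sup>2 + indicator (I n) x / measure M (I n)"

lemma w_measurable [measurable]: "w n \<in> borel_measurable M"
  unfolding w_def by measurable

lemma w_nonneg: "0 \<le> w n x"
  by (simp add: w_def)

lemma w_integrable: "integrable M (w n)"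
  unfolding w_def using g_sq_integrable[of n] indicator_I_integrable[of n] by simp

lemma w_integral_le: "integral\<^sup>L M (w n) \<le> 2"
proof -
  have "integral\<^sup>L M (w n) = (LINT x|M. (g n x)\<^sup>2) + measure M (I n) / measure M (I n)"
    unfolding w_def using g_sq_integrable[of n] indicator_I_integrable[of n] by simp
  with g_norm[of n] I_pos[of n] show ?thesis by simp
qed

text \<open>The earlier function is constant on the set that carries the later one, so the product
  is a constant multiple of the later function, which has mean zero.\<close>

lemma g_orthogonal:
  assumes "m \<noteq> n"
  shows "integrable M (\<lambda>x. g m x * g n x)" "(LINT x|M. g m x * g n x) = 0"
proof -
  have *: "integrable M (\<lambda>x. g m x * g n x) \<and> (LINT x|M. g m x * g n x) = 0" if "m < n" for m n
  proof -
    have "I n \<noteq> {}" using I_pos[of n] by force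
    then obtain y where y: "y \<in> I n" by blast
    have eq: "g m x * g n x = g m y * g n x" if "x \<in> space M" for x
      using g_zero[OF that, of n] g_const[OF \<open>m < n\<close> _ y, of x] by (cases "x \<in> I n") auto
    have "integrable M (\<lambda>x. g m y * g n x)" using g_integrable by simp
    moreover have "(LINT x|M. g m y * g n x) = 0" using g_mean by simp
    moreover have "integrable M (\<lambda>x. g m x * g n x) = integrable M (\<lambda>x. g m y * g n x)"
      "(LINT x|M. g m x * g n x) = (LINT x|M. g m y * g n x)"
      by (rule Bochner_Integration.integrable_cong[OF refl eq]
          Bochner_Integration.integral_cong[OF refl eq], assumption)+
    ultimately show ?thesis by (simp only:)
  qed
  have "integrable M (\<lambda>x. g m x * g n x) \<and> (LINT x|M. g m x * g n x) = 0"
  proof (cases "m < n")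
    case False
    then have "n < m" using assms by simp
    from *[OF this] show ?thesis by (simp only: mult.commute)
  qed (rule *)
  then show "integrable M (\<lambda>x. g m x * g n x)" "(LINT x|M. g m x * g n x) = 0"
    by blast+
qed

text \<open>Expanding the square leaves only the diagonal, since injectivity of \<rho> makes
  different summation indices refer to different, hence orthogonal, functions.\<close>

lemma sum_sq_integral_le:
  assumes "finite T" "inj_on \<rho> T"
  shows "integrable M (\<lambda>x. (\<Sum>n\<in>T. b n * g (\<rho> n) x)\<^sup>2)"
    and "(LINT x|M. (\<Sum>n\<in>T. b n * g (\<rho> n) x)\<^sup>2) \<le> (\<Sum>n\<in>T. (b n)\<^sup>2)"
proof -
  have int: "integrable M (\<lambda>x. g i x * g j x)" for i j
    using g_orthogonal(1)[of i j] g_sq_integrable[of i]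
    by (cases "i = j") (auto simp: power2_eq_square)
  have sq: "(\<Sum>n\<in>T. b n * g (\<rho> n) x)\<^sup>2
      = (\<Sum>i\<in>T. \<Sum>j\<in>T. b i * b j * (g (\<rho> i) x * g (\<rho> j) x))" for x
    unfolding power2_eq_square sum_product by (intro sum.cong refl) (simp add: mult_ac)
  show "integrable M (\<lambda>x. (\<Sum>n\<in>T. b n * g (\<rho> n) x)\<^sup>2)"
    unfolding sq using int by (intro Bochner_Integration.integrable_sum integrable_mult_right) auto
  have "(LINT x|M. (\<Sum>n\<in>T. b n * g (\<rho> n) x)\<^sup>2)
      = (\<Sum>i\<in>T. \<Sum>j\<in>T. b i * b j * (LINT x|M. g (\<rho> i) x * g (\<rho> j) x))"
    unfolding sq using int
    by (simp add: Bochner_Integration.integral_sum)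
  also have "\<dots> = (\<Sum>i\<in>T. \<Sum>j\<in>T. if i = j then (b i)\<^sup>2 * (LINT x|M. (g (\<rho> i) x)\<^sup>2) else 0)"
    using assms(2)
    by (intro sum.cong refl) (auto simp: power2_eq_square g_orthogonal(2) inj_on_eq_iff)
  also have "\<dots> = (\<Sum>i\<in>T. (b i)\<^sup>2 * (LINT x|M. (g (\<rho> i) x)\<^sup>2))"
    using assms(1) by (simp add: sum.delta)
  also have "\<dots> \<le> (\<Sum>i\<in>T. (b i)\<^sup>2)"
    by (intro sum_mono mult_left_le g_norm) auto
  finally show "(LINT x|M. (\<Sum>n\<in>T. b n * g (\<rho> n) x)\<^sup>2) \<le> (\<Sum>n\<in>T. (b n)\<^sup>2)" .
qed

section \<open>Exponential moments and self-normalized tails\<close>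

text \<open>With r the measure of \<open>I n\<close>, \<open>exp_diff_square_le\<close> bounds the
  integrand by exp (-u^2/r) * (1 + u g + u^2 g^2). The linear term integrates to 0 and the quadratic
  one to at most u^2, and r + u^2 <= r * exp (u^2/r) cancels the prefactor.\<close>

lemma nn_integral_exp_on_I_le:
  "(\<integral>\<^sup>+x. ennreal (exp (u * g n x - u\<^sup>2 * w n x)) * indicator (I n) x \<partial>M) \<le> emeasure M (I n)"
proof -
  define r where "r = measure M (I n)"
  have r: "r > 0" using I_pos by (simp add: r_def)
  \<comment> \<open>The indicator stands in place of the constant 1, so that the majorant vanishes
    off \<open>I n\<close> and can be integrated over the whole space.\<close>
  define P where "P x = exp (- (u\<^sup>2 / r)) * (indicator (I n) x + u * g n x + u\<^sup>2 * (g n x)\<^sup>2)" for x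
  have le: "exp (u * g n x - u\<^sup>2 * w n x) * indicator (I n) x \<le> P x" if "x \<in> space M" for x
  proof (cases "x \<in> I n")
    case True
    have "exp (u * g n x - u\<^sup>2 * w n x)
        = exp (- (u\<^sup>2 / r)) * exp (u * g n x - (u * g n x)\<^sup>2)"
      using True unfolding w_def r_def[symmetric]
      by (simp add: algebra_simps power_mult_distrib flip: exp_add)
    also have "\<dots> \<le> exp (- (u\<^sup>2 / r)) * (1 + u * g n x + (u * g n x)\<^sup>2)"
      by (intro mult_left_mono exp_diff_square_le) auto
    finally show ?thesis using True by (simp add: P_def power_mult_distrib)
  next
    case False
    then show ?thesis using g_zero[OF that] by (simp add: P_def)
  qed
  have nonneg: "0 \<le> P x" if "x \<in> space M" for x
    using le[OF that] by (rule order_trans[rotated]) simp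
  have int: "integrable M P"
    unfolding P_def using g_integrable g_sq_integrable indicator_I_integrable
    by (intro integrable_mult_right Bochner_Integration.integrable_add)
  have "(\<integral>\<^sup>+x. ennreal (exp (u * g n x - u\<^sup>2 * w n x)) * indicator (I n) x \<partial>M) \<le> (\<integral>\<^sup>+x. ennreal (P x) \<partial>M)"
  proof (intro nn_integral_mono)
    fix x assume "x \<in> space M"
    from le[OF this] show "ennreal (exp (u * g n x - u\<^sup>2 * w n x)) * indicator (I n) x \<le> ennreal (P x)"
      by (cases "x \<in> I n") (auto intro: ennreal_leI)
  qed
  also have "\<dots> = ennreal (integral\<^sup>L M P)"
    using int nonneg by (intro nn_integral_eq_integral) auto
  also have "integral\<^sup>L M P = exp (- (u\<^sup>2 / r)) * (r + u\<^sup>2 * (LINT x|M. (g n x)\<^sup>2))"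
    unfolding P_def using g_integrable[of n] g_sq_integrable[of n] indicator_I_integrable[of n]
    by (simp add: r_def g_mean)
  also have "\<dots> \<le> exp (- (u\<^sup>2 / r)) * (r * exp (u\<^sup>2 / r))"
  proof (intro mult_left_mono)
    have "r + u\<^sup>2 * (LINT x|M. (g n x)\<^sup>2) \<le> r + u\<^sup>2"
      using g_norm[of n] by (simp add: mult_left_le)
    also have "\<dots> = r * (1 + u\<^sup>2 / r)" using r by (simp add: field_simps)
    also have "\<dots> \<le> r * exp (u\<^sup>2 / r)" using r by (intro mult_left_mono) auto
    finally show "r + u\<^sup>2 * (LINT x|M. (g n x)\<^sup>2) \<le> r * exp (u\<^sup>2 / r)" .
  qed auto
  also have "\<dots> = r" by (simp add: exp_minus)
  finally show ?thesis
    by (simp add: r_def emeasure_eq_measure ennreal_leI)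
qed

text \<open>The function of largest index is integrated out first. Its factor \<open>E\<close> is 1
  off \<open>I n\<close>, while on \<open>I n\<close> the product \<open>F\<close> of the earlier
  factors is constant and comes out of the integral, so the previous lemma lets \<open>E\<close> be
  dropped.\<close>

lemma nn_integral_exp_sum_le:
  assumes "finite S"
  shows "(\<integral>\<^sup>+x. ennreal (exp (\<Sum>n\<in>S. u n * g n x - (u n)\<^sup>2 * w n x)) \<partial>M) \<le> 1"
  using assms
proof (induction S rule: finite_linorder_max_induct)
  case empty
  then show ?case by (simp add: emeasure_space_1)
next
  case (insert n A)
  define F where "F x = exp (\<Sum>n\<in>A. u n * g n x - (u n)\<^sup>2 * w n x)" for x
  define E where "E x = exp (u n * g n x - (u n)\<^sup>2 * w n x)" for x
  have [measurable]: "F \<in> borel_measurable M" "E \<in> borel_measurable M"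
    unfolding F_def E_def by measurable
  have "I n \<noteq> {}" using I_pos[of n] by force
  then obtain y where y: "y \<in> I n" by blast
  \<comment> \<open>\<open>g_const\<close> handles the earlier functions, \<open>I_nested\<close>
    the indicators inside \<open>w\<close>.\<close>
  have Fy: "F x = F y" if "x \<in> I n" for x
    using insert.hyps(2) g_const[OF _ that y] I_nested[OF _ that y]
    unfolding F_def w_def by (auto intro!: sum.cong arg_cong[of _ _ exp] simp: indicator_def)
  have "n \<notin> A" using insert.hyps(2) by blast
  then have "(\<integral>\<^sup>+x. ennreal (exp (\<Sum>n\<in>insert n A. u n * g n x - (u n)\<^sup>2 * w n x)) \<partial>M)
      = (\<integral>\<^sup>+x. ennreal (F x * E x) \<partial>M)"
    using insert.hyps(1) unfolding F_def E_def by (simp add: mult.commute flip: exp_add)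
  also have "\<dots> = (\<integral>\<^sup>+x. ennreal (F x) * indicator (space M - I n) x
      + ennreal (F y) * (ennreal (E x) * indicator (I n) x) \<partial>M)"
  proof (intro nn_integral_cong)
    fix x assume x: "x \<in> space M"
    show "ennreal (F x * E x) = ennreal (F x) * indicator (space M - I n) x
      + ennreal (F y) * (ennreal (E x) * indicator (I n) x)"
    proof (cases "x \<in> I n")
      case True
      then show ?thesis using Fy[OF True] by (simp add: ennreal_mult F_def E_def)
    next
      case False
      then show ?thesis using x g_zero[OF x False] by (simp add: E_def w_def)
    qed
  qed
  also have "\<dots> = (\<integral>\<^sup>+x. ennreal (F x) * indicator (space M - I n) x \<partial>M)
      + ennreal (F y) * (\<integral>\<^sup>+x. ennreal (E x) * indicator (I n) x \<partial>M)"
    by (subst nn_integral_add) (auto simp: nn_integral_cmult)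
  also have "\<dots> \<le> (\<integral>\<^sup>+x. ennreal (F x) * indicator (space M - I n) x \<partial>M)
      + ennreal (F y) * (\<integral>\<^sup>+x. indicator (I n) x \<partial>M)"
    using nn_integral_exp_on_I_le[of "u n" n] unfolding E_def
    by (intro add_left_mono mult_left_mono) auto
  also have "\<dots> = (\<integral>\<^sup>+x. ennreal (F x) * indicator (space M - I n) x
      + ennreal (F y) * indicator (I n) x \<partial>M)"
    by (subst nn_integral_add) (auto simp: nn_integral_cmult)
  also have "\<dots> = (\<integral>\<^sup>+x. ennreal (F x) \<partial>M)"
    by (intro nn_integral_cong) (auto simp: indicator_def Fy)
  also have "\<dots> \<le> 1" using insert.IH unfolding F_def .
  finally show ?case .
qed

lemma self_normalized_tail_one_sided:
  assumes "finite T" "inj_on \<rho> T" "0 < y" "0 < l"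
  shows "measure M {x\<in>space M. l \<le> (\<Sum>n\<in>T. b n * g (\<rho> n) x) \<and>
      (\<Sum>n\<in>T. (b n)\<^sup>2 * w (\<rho> n) x) \<le> y} \<le> exp (- (l\<^sup>2 / (4 * y)))"
proof -
  \<comment> \<open>This is the maximizer of t * l - t^2 * y, with maximum l^2 / (4 * y); the rest
    is Markov's inequality for the exponential.\<close>
  define t where "t = l / (2 * y)"
  have t: "t > 0" using assms by (simp add: t_def)
  \<comment> \<open>The coefficients are transported to the image of \<rho>, where the exponential
    bound orders the functions by their own index. The order of summation thus becomes
    irrelevant.\<close>
  define u where "u j = t * b (inv_into T \<rho> j)" for j
  define G where "G x = exp (\<Sum>n\<in>\<rho> ` T. u n * g n x - (u n)\<^sup>2 * w n x)" for x
  have [measurable]: "G \<in> borel_measurable M" unfolding G_def by measurable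
  have G: "G x = exp (t * (\<Sum>n\<in>T. b n * g (\<rho> n) x) - t\<^sup>2 * (\<Sum>n\<in>T. (b n)\<^sup>2 * w (\<rho> n) x))" for x
    unfolding G_def using assms(2)
    by (simp add: sum.reindex u_def inv_into_f_f sum_subtractf sum_distrib_left
        power_mult_distrib mult.assoc)
  let ?A = "{x\<in>space M. l \<le> (\<Sum>n\<in>T. b n * g (\<rho> n) x) \<and> (\<Sum>n\<in>T. (b n)\<^sup>2 * w (\<rho> n) x) \<le> y}"
  have A [measurable]: "?A \<in> sets M" by measurable
  define c where "c = exp (l\<^sup>2 / (4 * y))"
  have "c \<le> G x" if "x \<in> ?A" for x
  proof -
    have "l\<^sup>2 / (4 * y) = t * l - t\<^sup>2 * y"
      using assms(3) by (simp add: t_def field_simps power2_eq_square)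
    also have "\<dots> \<le> t * (\<Sum>n\<in>T. b n * g (\<rho> n) x) - t\<^sup>2 * (\<Sum>n\<in>T. (b n)\<^sup>2 * w (\<rho> n) x)"
      using that t by (intro diff_mono mult_left_mono) auto
    finally show ?thesis unfolding c_def G by simp
  qed
  then have "(\<integral>\<^sup>+x. ennreal c * indicator ?A x \<partial>M) \<le> (\<integral>\<^sup>+x. ennreal (G x) \<partial>M)"
    by (intro nn_integral_mono) (auto simp: indicator_def ennreal_leI)
  also have "\<dots> \<le> 1" unfolding G_def using assms(1) by (intro nn_integral_exp_sum_le) simp
  finally have "ennreal c * emeasure M ?A \<le> 1"
    by (simp add: nn_integral_cmult)
  then have "ennreal (c * measure M ?A) \<le> ennreal 1"
    by (simp add: emeasure_eq_measure ennreal_mult c_def)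
  then have "c * measure M ?A \<le> 1" by (subst (asm) ennreal_le_iff) auto
  then show ?thesis by (simp add: c_def exp_minus field_simps)
qed

lemma self_normalized_tail:
  assumes "finite T" "inj_on \<rho> T" "0 < y" "0 < l"
  shows "measure M {x\<in>space M. l \<le> \<bar>\<Sum>n\<in>T. b n * g (\<rho> n) x\<bar> \<and>
      (\<Sum>n\<in>T. (b n)\<^sup>2 * w (\<rho> n) x) \<le> y} \<le> 2 * exp (- (l\<^sup>2 / (4 * y)))"
proof -
  let ?A = "\<lambda>b. {x\<in>space M. l \<le> (\<Sum>n\<in>T. b n * g (\<rho> n) x) \<and> (\<Sum>n\<in>T. (b n)\<^sup>2 * w (\<rho> n) x) \<le> y}"
  have "{x\<in>space M. l \<le> \<bar>\<Sum>n\<in>T. b n * g (\<rho> n) x\<bar> \<and> (\<Sum>n\<in>T. (b n)\<^sup>2 * w (\<rho> n) x) \<le> y}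
      \<subseteq> ?A b \<union> ?A (\<lambda>n. - b n)"
    by (auto simp: sum_negf)
  then have "measure M {x\<in>space M. l \<le> \<bar>\<Sum>n\<in>T. b n * g (\<rho> n) x\<bar> \<and> (\<Sum>n\<in>T. (b n)\<^sup>2 * w (\<rho> n) x) \<le> y}
      \<le> measure M (?A b \<union> ?A (\<lambda>n. - b n))"
    by (intro finite_measure_mono) measurable
  also have "\<dots> \<le> measure M (?A b) + measure M (?A (\<lambda>n. - b n))"
    by (intro measure_Un_le) measurable
  also have "\<dots> \<le> exp (- (l\<^sup>2 / (4 * y))) + exp (- (l\<^sup>2 / (4 * y)))"
    using assms by (intro add_mono self_normalized_tail_one_sided)
  finally show ?thesis by simp
qed

section \<open>Block maxima and almost everywhere convergence\<close>

text \<open>A union bound over the partial sums. There are at most exp (2 * 2^k) of them, each with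
  tail 2 * exp (-3 * 2^k), which leaves 2 * exp (-(2^k)).\<close>

lemma block_maximum_tail:
  assumes "inj \<rho>" "0 < e"
  shows "measure M {x\<in>space M. (\<exists>m\<in>{2^2^k..<2^2^Suc k::nat}. e \<le> \<bar>\<Sum>n\<in>{2^2^k..<m}. b n * g (\<rho> n) x\<bar>) \<and>
      2^k * (\<Sum>n\<in>{2^2^k..<2^2^Suc k}. (b n)\<^sup>2 * w (\<rho> n) x) \<le> e\<^sup>2 / 12} \<le> 2 * (1/2)^k"
proof -
  let ?B = "{2^2^k..<2^2^Suc k::nat}"
  \<comment> \<open>The 12 makes e^2 / (4 * y) = 3 * 2^k, enough to beat the exponent 2 * 2^k of the
    count.\<close>
  define y where "y = e\<^sup>2 / (12 * 2^k)"
  have y: "y > 0" using assms(2) by (simp add: y_def)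
  define A where "A m = {x\<in>space M. e \<le> \<bar>\<Sum>n\<in>{2^2^k..<m}. b n * g (\<rho> n) x\<bar> \<and>
      (\<Sum>n\<in>{2^2^k..<m}. (b n)\<^sup>2 * w (\<rho> n) x) \<le> y}" for m
  have A_sets [measurable]: "A m \<in> sets M" for m unfolding A_def by measurable
  have "{x\<in>space M. (\<exists>m\<in>?B. e \<le> \<bar>\<Sum>n\<in>{2^2^k..<m}. b n * g (\<rho> n) x\<bar>) \<and>
      2^k * (\<Sum>n\<in>?B. (b n)\<^sup>2 * w (\<rho> n) x) \<le> e\<^sup>2 / 12} \<subseteq> (\<Union>m\<in>?B. A m)"
  proof clarify
    fix x m assume x: "x \<in> space M" "m \<in> ?B" "e \<le> \<bar>\<Sum>n\<in>{2^2^k..<m}. b n * g (\<rho> n) x\<bar>"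
      "2^k * (\<Sum>n\<in>?B. (b n)\<^sup>2 * w (\<rho> n) x) \<le> e\<^sup>2 / 12"
    \<comment> \<open>Since \<open>w\<close> is nonnegative, the single condition on the whole block
      controls the variation of each of its partial sums.\<close>
    have "(\<Sum>n\<in>{2^2^k..<m}. (b n)\<^sup>2 * w (\<rho> n) x) \<le> (\<Sum>n\<in>?B. (b n)\<^sup>2 * w (\<rho> n) x)"
      using x(2) by (intro sum_mono2) (auto simp: w_nonneg)
    also have "\<dots> \<le> y" using x(4) by (simp add: y_def field_simps)
    finally show "x \<in> (\<Union>m\<in>?B. A m)" using x by (auto simp: A_def)
  qed
  then have "measure M {x\<in>space M. (\<exists>m\<in>?B. e \<le> \<bar>\<Sum>n\<in>{2^2^k..<m}. b n * g (\<rho> n) x\<bar>) \<and>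
      2^k * (\<Sum>n\<in>?B. (b n)\<^sup>2 * w (\<rho> n) x) \<le> e\<^sup>2 / 12} \<le> measure M (\<Union>m\<in>?B. A m)"
    by (intro finite_measure_mono) auto
  also have "\<dots> \<le> (\<Sum>m\<in>?B. measure M (A m))"
    by (intro finite_measure_subadditive_finite) auto
  also have "\<dots> \<le> (\<Sum>m\<in>?B. 2 * exp (- (e\<^sup>2 / (4 * y))))"
    using assms y unfolding A_def
    by (intro sum_mono self_normalized_tail) (auto intro: inj_on_subset)
  also have "e\<^sup>2 / (4 * y) = 3 * 2^k" using assms(2) by (simp add: y_def field_simps)
  also have "(\<Sum>m\<in>?B. 2 * exp (- (3 * 2^k))) \<le> 2^2^Suc k * (2 * exp (- (3 * 2^k :: real)))"
  proof -
    have "real (card ?B) \<le> 2^2^Suc k" by (simp add: of_nat_diff)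
    then show ?thesis by (simp add: mult_right_mono)
  qed
  also have "\<dots> \<le> exp (2 * 2^k) * (2 * exp (- (3 * 2^k :: real)))"
  proof -
    have "(2::real)^2^Suc k \<le> exp 1 ^ 2^Suc k"
      using exp_ge_add_one_self[of 1] by (intro power_mono) auto
    also have "\<dots> = exp (2 * 2^k)" by (simp flip: exp_of_nat_mult)
    finally show ?thesis by (intro mult_right_mono) auto
  qed
  also have "\<dots> = 2 * exp (- (2^k))" by (simp flip: exp_add)
  also have "\<dots> \<le> 2 * (1/2)^k"
  proof -
    have "2^k \<le> exp (2^k :: real)" using exp_ge_add_one_self[of "2^k::real"] by linarith
    then show ?thesis by (simp add: exp_minus power_one_over field_simps)
  qed
  finally show ?thesis .
qed

theorem AE_summable_rearrangement:
  assumes \<rho>: "inj \<rho>" and b: "summable (\<lambda>n. (b n)\<^sup>2 * log 2 (real (Suc n)))"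
  shows "AE x in M. summable (\<lambda>n. b n * g (\<rho> n) x)"
proof -
  define N where "N k = (2::nat)^2^k" for k :: nat
  have N: "strict_mono N" by (simp add: N_def strict_mono_Suc_iff)
  define V where "V k x = (\<Sum>n = N k..<N (Suc k). (b n)\<^sup>2 * w (\<rho> n) x)" for k x
  define D where "D k x = (\<Sum>n = N k..<N (Suc k). b n * g (\<rho> n) x)" for k x
  \<comment> \<open>One summable majorant serves twice: f k x -> 0 forces the smallness of 2^k * V k
    x, and summability controls the complete block sums \<open>D\<close>.\<close>
  define f where "f k x = 2^k * (V k x + (D k x)\<^sup>2)" for k x
  define c where "c n = (b n)\<^sup>2 * log 2 (real (Suc n))" for n
  have c_nonneg: "0 \<le> c n" for n by (simp add: c_def)
  have inj: "inj_on \<rho> T" for T using \<rho> by (rule inj_on_subset) simp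
  have V_nonneg: "0 \<le> V k x" for k x
    unfolding V_def by (intro sum_nonneg) (auto simp: w_nonneg)
  have V_int: "integrable M (V k)" for k
    unfolding V_def using w_integrable by (intro Bochner_Integration.integrable_sum integrable_mult_right)
  have D_int: "integrable M (\<lambda>x. (D k x)\<^sup>2)" for k
    unfolding D_def using inj by (intro sum_sq_integral_le) auto
  have [measurable]: "V k \<in> borel_measurable M" "D k \<in> borel_measurable M" for k
    unfolding V_def D_def by measurable
  have f_int: "integrable M (f k)" for k
    unfolding f_def using V_int D_int by auto
  \<comment> \<open>The 3 is 2 from the integral of each \<open>w\<close> plus 1 from the mean
    square of \<open>D\<close>.\<close>
  have f_le: "integral\<^sup>L M (f k) \<le> 3 * (\<Sum>n = N k..<N (Suc k). c n)" for k
  proof -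
    have "integral\<^sup>L M (V k) = (\<Sum>n = N k..<N (Suc k). (b n)\<^sup>2 * integral\<^sup>L M (w (\<rho> n)))"
      unfolding V_def using w_integrable by simp
    also have "\<dots> \<le> (\<Sum>n = N k..<N (Suc k). (b n)\<^sup>2 * 2)"
      by (intro sum_mono mult_left_mono w_integral_le) auto
    finally have V: "integral\<^sup>L M (V k) \<le> 2 * (\<Sum>n = N k..<N (Suc k). (b n)\<^sup>2)"
      by (simp add: sum_distrib_left mult.commute)
    have D: "(LINT x|M. (D k x)\<^sup>2) \<le> (\<Sum>n = N k..<N (Suc k). (b n)\<^sup>2)"
      unfolding D_def using inj by (intro sum_sq_integral_le) auto
    have "integral\<^sup>L M (f k) = 2^k * (integral\<^sup>L M (V k) + (LINT x|M. (D k x)\<^sup>2))"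
      unfolding f_def using V_int D_int by simp
    also have "\<dots> \<le> 2^k * (3 * (\<Sum>n = N k..<N (Suc k). (b n)\<^sup>2))"
      using V D by (intro mult_left_mono) auto
    also have "\<dots> = 3 * (\<Sum>n = N k..<N (Suc k). (b n)\<^sup>2 * 2^k)"
      by (simp add: sum_distrib_left mult_ac)
    also have "\<dots> \<le> 3 * (\<Sum>n = N k..<N (Suc k). c n)"
    proof -
      \<comment> \<open>Indices start at 0 here, so the weight of the n-th term is the logarithm of
        n + 1, which on the block is at least log 2 (N k) = 2^k.\<close>
      have "(2::real)^k \<le> log 2 (real (Suc n))" if "N k \<le> n" for n
      proof -
        have "real (N k) \<le> real (Suc n)" using that by simp
        then have "log 2 (real (N k)) \<le> log 2 (real (Suc n))"
          by (subst log_le_cancel_iff) (auto simp: N_def)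
        moreover have "log 2 (real (N k)) = 2^k" by (simp add: N_def log_nat_power)
        ultimately show ?thesis by simp
      qed
      then show ?thesis unfolding c_def by (intro mult_left_mono sum_mono) auto
    qed
    finally show ?thesis .
  qed
  have "summable (\<lambda>k. integral\<^sup>L M (f k))"
  proof (rule summableI_nonneg_bounded)
    show "0 \<le> integral\<^sup>L M (f k)" for k
      by (intro Bochner_Integration.integral_nonneg) (auto simp: f_def V_nonneg)
    fix K
    have "(\<Sum>k<K. \<Sum>n = N k..<N (Suc k). c n) = (\<Sum>n = N 0..<N K. c n)"
    proof (induction K)
      case (Suc K)
      have "N 0 \<le> N K" "N K \<le> N (Suc K)" using N by (auto simp: strict_mono_less_eq)
      with Suc show ?case by (simp add: sum.atLeastLessThan_concat)
    qed simp
    also have "\<dots> \<le> suminf c"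
      using b c_nonneg unfolding c_def[symmetric] by (intro sum_le_suminf) auto
    finally have "(\<Sum>k<K. 3 * (\<Sum>n = N k..<N (Suc k). c n)) \<le> 3 * suminf c"
      by (simp flip: sum_distrib_left)
    with sum_mono[OF f_le] show "(\<Sum>k<K. integral\<^sup>L M (f k)) \<le> 3 * suminf c"
      by (rule order_trans)
  qed
  then have AE_f: "AE x in M. summable (\<lambda>k. f k x)"
    by (rule AE_summable_of_summable_integral[OF f_int, rotated]) (simp add: f_def V_nonneg)
  define A where "A e k = {x\<in>space M. (\<exists>m\<in>{N k..<N (Suc k)}. e \<le> \<bar>\<Sum>n = N k..<m. b n * g (\<rho> n) x\<bar>) \<and>
      2^k * V k x \<le> e\<^sup>2 / 12}" for e k
  \<comment> \<open>Restricting the threshold to 1 / (j + 1) keeps the union of the exceptional null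
    sets countable.\<close>
  have "AE x in M. \<forall>\<^sub>F k in sequentially. x \<in> space M - A (1 / real (Suc j)) k" for j
  proof (intro borel_cantelli_AE1)
    show "A (1 / real (Suc j)) k \<in> sets M" for k unfolding A_def by measurable
    have "norm (measure M (A (1 / real (Suc j)) k)) \<le> 2 * (1/2)^k" for k
      using block_maximum_tail[OF \<rho>, of "1 / real (Suc j)" k b]
      by (simp add: A_def V_def N_def)
    moreover have "summable (\<lambda>k. 2 * (1/2 :: real)^k)"
      by (intro summable_mult summable_geometric) simp
    ultimately show "summable (\<lambda>k. measure M (A (1 / real (Suc j)) k))"
      by (metis (no_types, lifting) summable_comparison_test')
  qed (simp add: emeasure_eq_measure)
  then have "AE x in M. \<forall>j. \<forall>\<^sub>F k in sequentially. x \<in> space M - A (1 / real (Suc j)) k"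
    by (simp add: AE_all_countable)
  with AE_f show ?thesis
  proof eventually_elim
    fix x assume f: "summable (\<lambda>k. f k x)"
      and A: "\<forall>j. \<forall>\<^sub>F k in sequentially. x \<in> space M - A (1 / real (Suc j)) k"
    show "summable (\<lambda>n. b n * g (\<rho> n) x)"
    proof (rule summable_of_blocks[OF N])
      \<comment> \<open>The inequality 2 * |D| <= 2^(-k) + 2^k * D^2 trades the weighted square
        summability for absolute convergence.\<close>
      have D_le: "norm (D k x) \<le> (1/2)^k + f k x" for k
      proof -
        have "0 \<le> (1 - 2^k * \<bar>D k x\<bar>)\<^sup>2" by simp
        then have "2 * (2^k * \<bar>D k x\<bar>) \<le> 1 + (2^k)\<^sup>2 * (D k x)\<^sup>2"
          by (simp add: power2_diff power_mult_distrib)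
        then have "2 * \<bar>D k x\<bar> \<le> (1/2)^k + 2^k * (D k x)\<^sup>2"
          by (simp add: field_simps power_one_over power2_eq_square)
        also have "\<dots> \<le> (1/2)^k + f k x" by (simp add: f_def V_nonneg)
        finally show ?thesis by simp
      qed
      have "summable (\<lambda>k. (1/2)^k + f k x)"
        using f by (intro summable_add summable_geometric) auto
      then show "summable (\<lambda>k. \<Sum>n = N k..<N (Suc k). b n * g (\<rho> n) x)"
        unfolding D_def[symmetric] by (rule summable_comparison_test') (rule D_le)
    next
      fix e :: real assume "0 < e"
      then obtain j where j: "1 / real (Suc j) < e" using nat_approx_posE by blast
      define d where "d = 1 / real (Suc j)"
      have "(\<lambda>k. f k x) \<longlonglongrightarrow> 0" using f by (rule summable_LIMSEQ_zero)
      then have "\<forall>\<^sub>F k in sequentially. f k x < d\<^sup>2 / 12"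
        by (rule order_tendstoD) (simp add: d_def)
      with A[THEN spec, of j]
      show "\<forall>\<^sub>F k in sequentially. \<forall>m\<in>{N k..<N (Suc k)}. \<bar>\<Sum>n = N k..<m. b n * g (\<rho> n) x\<bar> \<le> e"
      proof eventually_elim
        case (elim k)
        have "2^k * V k x \<le> f k x" by (simp add: f_def)
        with elim have "\<not> (\<exists>m\<in>{N k..<N (Suc k)}. d \<le> \<bar>\<Sum>n = N k..<m. b n * g (\<rho> n) x\<bar>)"
          unfolding A_def d_def[symmetric] by auto
        then have "\<bar>\<Sum>n = N k..<m. b n * g (\<rho> n) x\<bar> < d" if "m \<in> {N k..<N (Suc k)}" for m
          using that by (meson not_le)
        with j show ?case unfolding d_def[symmetric] by (meson less_imp_le less_trans)
      qed
    qed
  qed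
qed

end

section \<open>Generalized Haar systems as nested differences\<close>

lemma prob_space_unit_leb: "prob_space unit_leb"
  by (rule prob_spaceI) (simp add: emeasure_restrict_space)

lemma measure_unit_leb_atLeastLessThan:
  assumes "0 \<le> a" "a \<le> b" "b \<le> 1"
  shows "{a..<b} \<in> sets unit_leb" "measure unit_leb {a..<b} = b - a"
proof -
  have sub: "{a..<b} \<subseteq> {0..<1}" using assms by auto
  then show "{a..<b} \<in> sets unit_leb" by (simp add: sets_restrict_space_iff)
  show "measure unit_leb {a..<b} = b - a"
    using sub assms by (simp add: measure_restrict_space)
qed

text \<open>Applied to an atom that survives a split, this shows that a Haar function lives only on
  the interval being split.\<close>

lemma constant_on_zero_of_integral_zero:
  assumes "f constant_on A" "A \<in> sets M" "0 < measure M A" "(LINT x:A|M. f x) = 0" "x \<in> A"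
  shows "f x = (0::real)"
proof -
  obtain c where c: "\<And>y. y \<in> A \<Longrightarrow> f y = c" using assms(1) unfolding constant_on_def by blast
  have "(LINT x:A|M. f x) = (LINT x:A|M. c)"
    by (intro set_lebesgue_integral_cong) (use assms c in auto)
  also have "\<dots> = measure M A * c"
    using assms(2) by (simp add: set_lebesgue_integral_def)
  finally show ?thesis using assms c by simp
qed

lemma splits_refines:
  assumes "splits_one_interval P Q" "A \<in> Q"
  shows "\<exists>B\<in>P. A \<subseteq> B"
proof -
  from assms(1) obtain \<alpha> \<gamma> \<beta> where *: "\<alpha> < \<gamma>" "\<gamma> < \<beta>" "{\<alpha>..<\<beta>} \<in> P"
    "Q = (P - {{\<alpha>..<\<beta>}}) \<union> {{\<alpha>..<\<gamma>}, {\<gamma>..<\<beta>}}"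
    unfolding splits_one_interval_def by blast
  have "{\<alpha>..<\<gamma>} \<subseteq> {\<alpha>..<\<beta>}" "{\<gamma>..<\<beta>} \<subseteq> {\<alpha>..<\<beta>}" using * by auto
  with *(3,4) assms(2) show ?thesis by blast
qed

text \<open>For n >= 2 the support \<open>I n\<close> is the atom of the partition n - 1 that is
  split to form partition n. Earlier functions are constant on it, because it lies inside an atom of
  every earlier partition.\<close>

lemma generalized_Haar_nested_differences:
  assumes "generalized_Haar_system h"
  obtains I where "nested_differences unit_leb (\<lambda>n. if n \<le> 1 then (\<lambda>_. 0) else h n) I"
    and "\<And>n. 1 \<le> n \<Longrightarrow> integrable unit_leb (h n)"
    and "\<And>n. 1 \<le> n \<Longrightarrow> (LINT x|unit_leb. (h n x)\<^sup>2) = 1"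
    and "h 1 constant_on {0..<1}"
proof -
  from assms obtain \<A> where mart: "martingale_difference \<A> h"
    and norm: "\<And>n. 1 \<le> n \<Longrightarrow> L2_norm_unit (h n) = 1"
    and A1: "\<A> 1 = {{0..<1}}"
    and split: "\<And>n. 1 \<le> n \<Longrightarrow> splits_one_interval (\<A> n) (\<A> (n + 1))"
    unfolding generalized_Haar_system_def by blast
  from mart have part: "\<And>n. 1 \<le> n \<Longrightarrow> unit_partition (\<A> n)"
    and int: "\<And>n. 1 \<le> n \<Longrightarrow> integrable unit_leb (h n)"
    and const: "\<And>n A. 1 \<le> n \<Longrightarrow> A \<in> \<A> n \<Longrightarrow> h n constant_on A"
    and mean: "\<And>n A. 2 \<le> n \<Longrightarrow> A \<in> \<A> (n - 1) \<Longrightarrow> (LINT x:A|unit_leb. h n x) = 0"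
    unfolding martingale_difference_def unit_filtration_def by blast+
  have norm1: "(LINT x|unit_leb. (h n x)\<^sup>2) = 1" if "1 \<le> n" for n
    using norm[OF that] by (simp add: L2_norm_unit_def)
  \<comment> \<open>Tracking the shape of the atoms guarantees that each has positive
    measure.\<close>
  have interval: "\<exists>a b. 0 \<le> a \<and> a < b \<and> b \<le> 1 \<and> A = {a..<b}" if "1 \<le> n" "A \<in> \<A> n" for n A
    using that
  proof (induction n arbitrary: A rule: nat_induct_at_least)
    case base
    then show ?case using A1 by (intro exI[of _ "0::real"] exI[of _ "1::real"]) simp
  next
    case (Suc n)
    from split[OF Suc.hyps] obtain \<alpha> \<gamma> \<beta> where *: "\<alpha> < \<gamma>" "\<gamma> < \<beta>" "{\<alpha>..<\<beta>} \<in> \<A> n"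
      "\<A> (Suc n) = (\<A> n - {{\<alpha>..<\<beta>}}) \<union> {{\<alpha>..<\<gamma>}, {\<gamma>..<\<beta>}}"
      unfolding splits_one_interval_def by auto
    have "0 \<le> \<alpha> \<and> \<beta> \<le> 1"
    proof -
      obtain a b where ab: "0 \<le> a" "a < b" "b \<le> 1" "{\<alpha>..<\<beta>} = {a..<b}"
        using Suc.IH[OF *(3)] by blast
      \<comment> \<open>A nonempty half-open interval determines its endpoints.\<close>
      moreover have "\<alpha> = a \<and> \<beta> = b"
        using ab *(1,2) atLeastLessThan_inj[OF ab(4)] by simp
      ultimately show ?thesis by simp
    qed
    moreover have "A \<in> \<A> n \<or> A = {\<alpha>..<\<gamma>} \<or> A = {\<gamma>..<\<beta>}"
      using Suc.prems *(4) by blast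
    ultimately show ?case
    proof (elim disjE)
      assume "A = {\<alpha>..<\<gamma>}"
      with \<open>0 \<le> \<alpha> \<and> \<beta> \<le> 1\<close> *(1,2) show ?thesis
        by (intro exI[of _ \<alpha>] exI[of _ \<gamma>]) simp
    next
      assume "A = {\<gamma>..<\<beta>}"
      with \<open>0 \<le> \<alpha> \<and> \<beta> \<le> 1\<close> *(1,2) show ?thesis
        by (intro exI[of _ \<gamma>] exI[of _ \<beta>]) simp
    qed (rule Suc.IH)
  qed
  have atom_sets: "A \<in> sets unit_leb" and atom_pos: "0 < measure unit_leb A"
    and atom_sub: "A \<subseteq> {0..<1}" if "1 \<le> n" "A \<in> \<A> n" for n A
    using interval[OF that] by (auto simp: measure_unit_leb_atLeastLessThan)
  have atom_eq: "A = B" if "1 \<le> n" "A \<in> \<A> n" "B \<in> \<A> n" "x \<in> A" "x \<in> B" for n A B x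
    using part[OF that(1)] that unfolding unit_partition_def disjoint_def by blast
  have refine: "\<exists>B\<in>\<A> m. A \<subseteq> B" if m: "1 \<le> m" and "m \<le> n" "A \<in> \<A> n" for m n A
    using that(2,3)
  proof (induction n arbitrary: A rule: dec_induct)
    case (step n)
    have "\<exists>B\<in>\<A> n. A \<subseteq> B"
      by (rule splits_refines[OF split[of n]]) (use step m in auto)
    then obtain B where B: "B \<in> \<A> n" "A \<subseteq> B" by blast
    from step.IH[OF B(1)] B(2) show ?case by blast
  qed blast
  have "\<exists>J. J \<in> \<A> n \<and> (\<forall>A\<in>\<A> n. A \<noteq> J \<longrightarrow> A \<in> \<A> (Suc n))" if "1 \<le> n" for n
    using split[OF that] unfolding splits_one_interval_def by auto
  then obtain J where J: "\<And>n. 1 \<le> n \<Longrightarrow> J n \<in> \<A> n"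
    and J_keep: "\<And>n A. 1 \<le> n \<Longrightarrow> A \<in> \<A> n \<Longrightarrow> A \<noteq> J n \<Longrightarrow> A \<in> \<A> (Suc n)"
    by metis
  define I where "I n = (if n \<le> 1 then {0..<1} else J (n - 1))" for n
  \<comment> \<open>The \<open>max\<close> covers n <= 1, where \<open>I n\<close> is the whole
    interval, the only atom of the first partition.\<close>
  have I: "I n \<in> \<A> (max 1 (n - 1))" for n
    using J[of "n - 1"] A1 by (auto simp: I_def max_def)
  have h_zero: "h n x = 0" if n: "2 \<le> n" and x: "x \<in> {0..<1}" "x \<notin> I n" for n x
  proof -
    have "1 \<le> n - 1" using n by simp
    from part[OF this] x(1) have "x \<in> \<Union>(\<A> (n - 1))" unfolding unit_partition_def by blast
    then obtain A where A: "A \<in> \<A> (n - 1)" "x \<in> A" by blast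
    have "A \<noteq> J (n - 1)" using A(2) x(2) n by (auto simp: I_def)
    \<comment> \<open>An atom that is kept belongs to both partitions, so \<open>h n\<close> is
      constant on it and also has integral zero over it.\<close>
    then have "A \<in> \<A> n"
      using J_keep[of "n - 1" A] A(1) n by auto
    show ?thesis
    proof (rule constant_on_zero_of_integral_zero[OF _ _ _ _ A(2)])
      show "h n constant_on A" using const[of n A] \<open>A \<in> \<A> n\<close> n by simp
      show "A \<in> sets unit_leb" "0 < measure unit_leb A"
        using atom_sets[of n A] atom_pos[of n A] \<open>A \<in> \<A> n\<close> n by simp_all
      show "(LINT y:A|unit_leb. h n y) = 0" using mean[OF n A(1)] .
    qed
  qed
  have "nested_differences unit_leb (\<lambda>n. if n \<le> 1 then (\<lambda>_. 0) else h n) I"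
  proof (intro nested_differences.intro prob_space_unit_leb nested_differences_axioms.intro)
    fix n
    show "I n \<in> sets unit_leb" "0 < measure unit_leb (I n)"
      using atom_sets[OF _ I] atom_pos[OF _ I] by simp_all
    show "integrable unit_leb (if n \<le> 1 then (\<lambda>_. 0) else h n)"
      using int by simp
    show "integrable unit_leb (\<lambda>x. ((if n \<le> 1 then (\<lambda>_. 0) else h n) x)\<^sup>2)"
    proof (cases "n \<le> 1")
      case False
      \<comment> \<open>A nonintegrable square would have Bochner integral 0, not 1.\<close>
      then have "integrable unit_leb (\<lambda>x. (h n x)\<^sup>2)"
        using norm1[of n] not_integrable_integral_eq[of unit_leb "\<lambda>x. (h n x)\<^sup>2"] by force
      with False show ?thesis by simp
    qed simp
    show "(if n \<le> 1 then (\<lambda>_. 0) else h n) x = 0" if "x \<in> space unit_leb" "x \<notin> I n" for x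
      using h_zero[of n x] that by simp
    show "integral\<^sup>L unit_leb (if n \<le> 1 then (\<lambda>_. 0) else h n) = 0"
    proof (cases "n \<le> 1")
      case False
      have "integral\<^sup>L unit_leb (h n) = (LINT x:I n|unit_leb. h n x)"
        unfolding set_lebesgue_integral_def
        using h_zero[of n] False by (intro Bochner_Integration.integral_cong) (auto simp: indicator_def)
      also have "\<dots> = 0" using mean[of n "I n"] I[of n] False by (simp add: max_def split: if_splits)
      finally show ?thesis using False by simp
    qed simp
    show "(LINT x|unit_leb. ((if n \<le> 1 then (\<lambda>_. 0) else h n) x)\<^sup>2) \<le> 1"
      using norm1[of n] by simp
    fix m x y assume m: "m < n" and xy: "x \<in> I n" "y \<in> I n"
    have sub: "x \<in> {0..<1}" "y \<in> {0..<1}" using xy atom_sub[OF _ I[of n]] by auto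
    show "(if m \<le> 1 then (\<lambda>_. 0) else h m) x = (if m \<le> 1 then (\<lambda>_. 0) else h m) y"
    proof (cases "m \<le> 1")
      case False
      have "\<exists>B\<in>\<A> m. I n \<subseteq> B"
        by (rule refine[OF _ _ I]) (use m False in auto)
      then obtain B where "B \<in> \<A> m" "I n \<subseteq> B" by blast
      moreover from const[OF _ this(1)] False obtain c where "\<And>z. z \<in> B \<Longrightarrow> h m z = c"
        unfolding constant_on_def by auto
      ultimately have "h m x = h m y" using xy by (metis subsetD)
      with False show ?thesis by simp
    qed simp
    show "x \<in> I m \<longleftrightarrow> y \<in> I m"
    proof (cases "m \<le> 1")
      case True
      then show ?thesis using sub by (simp add: I_def)
    next
      case False
      have "\<exists>B\<in>\<A> (max 1 (m - 1)). I n \<subseteq> B"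
        by (rule refine[OF _ _ I]) (use m False in auto)
      then obtain B where B: "B \<in> \<A> (max 1 (m - 1))" "I n \<subseteq> B" by blast
      \<comment> \<open>\<open>B\<close> and \<open>I m\<close> are atoms of the same partition, so
        they coincide or are disjoint; thus \<open>I n\<close> lies inside \<open>I m\<close> or
        misses it.\<close>
      then have "B = I m" if "z \<in> B" "z \<in> I m" for z
        using atom_eq[OF _ B(1) I that] by simp
      with B(2) xy show ?thesis by blast
    qed
  qed
  moreover have "h 1 constant_on {0..<1}" using const[of 1] A1 by simp
  ultimately show ?thesis using that int norm1 by blast
qed

section \<open>The multiplier property for rearrangements\<close>

theorem corollary1p2:
  fixes h :: "nat \<Rightarrow> real \<Rightarrow> real" and \<sigma> :: "nat \<Rightarrow> nat"
  assumes "generalized_Haar_system h"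
    and "bij_betw \<sigma> {1..} {1..}"
  shows "C_multiplier (\<lambda>n. log 2 (real n)) (\<lambda>n. h (\<sigma> n))"
proof -
  define g where "g = (\<lambda>n. if n \<le> 1 then (\<lambda>_. 0) else h n)"
  obtain I where "nested_differences unit_leb g I"
    and int: "\<And>n. 1 \<le> n \<Longrightarrow> integrable unit_leb (h n)"
    and norm: "\<And>n. 1 \<le> n \<Longrightarrow> (LINT x|unit_leb. (h n x)\<^sup>2) = 1"
    and const: "h 1 constant_on {0..<1}"
    using generalized_Haar_nested_differences[OF assms(1)] unfolding g_def by blast
  interpret nested_differences unit_leb g I by fact
  have \<sigma>: "1 \<le> \<sigma> n" if "1 \<le> n" for n using assms(2) that bij_betwE by fastforce
  have inj: "inj (\<lambda>n. \<sigma> (Suc n))"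
    using assms(2) unfolding bij_betw_def inj_on_def by auto
  obtain c where c: "\<And>x. x \<in> {0..<1} \<Longrightarrow> h 1 x = c" using const unfolding constant_on_def by blast
  \<comment> \<open>The first function is constant on the unit interval, so orthogonality to it is
    the mean-zero property of the others.\<close>
  have orth1: "(LINT x|unit_leb. h 1 x * h n x) = 0" if "2 \<le> n" for n
  proof -
    have "(LINT x|unit_leb. h 1 x * h n x) = (LINT x|unit_leb. c * g n x)"
      using that c by (intro Bochner_Integration.integral_cong) (auto simp: g_def)
    also have "\<dots> = 0" by (simp add: g_mean)
    finally show ?thesis .
  qed
  have orth: "(LINT x|unit_leb. h m x * h n x) = (if m = n then 1 else 0)" if "1 \<le> m" "1 \<le> n" for m n
  proof -
    have "m = n \<or> m = 1 \<and> 2 \<le> n \<or> n = 1 \<and> 2 \<le> m \<or> m \<noteq> n \<and> 2 \<le> m \<and> 2 \<le> n"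
      using that by presburger
    then consider "m = n" | "m = 1" "2 \<le> n" | "n = 1" "2 \<le> m" | "m \<noteq> n" "2 \<le> m" "2 \<le> n"
      by blast
    then show ?thesis
    proof cases
      case 1
      then show ?thesis using norm[OF that(1)] by (simp add: power2_eq_square)
    next
      case 2
      then show ?thesis using orth1 by simp
    next
      case 3
      then show ?thesis using orth1[of m] by (simp add: mult.commute)
    next
      case 4
      then show ?thesis using g_orthogonal(2)[of m n] by (simp add: g_def)
    qed
  qed
  show ?thesis
    unfolding C_multiplier_def orthonormal_system_def
  proof (intro conjI allI impI)
    show "mono_on {1..} (\<lambda>n. log 2 (real n))" by (auto intro!: mono_onI)
    show "filterlim (\<lambda>n. log 2 (real n)) at_top sequentially" by real_asymp
    show "h (\<sigma> n) \<in> borel_measurable unit_leb" if "1 \<le> n" for n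
      using int[OF \<sigma>[OF that]] by auto
    show "(LINT x|unit_leb. h (\<sigma> m) x * h (\<sigma> n) x) = (if m = n then 1 else 0)"
      if "1 \<le> m" "1 \<le> n" for m n
      using orth[OF \<sigma>[OF that(1)] \<sigma>[OF that(2)]] assms(2) that
      by (auto simp: bij_betw_def inj_on_eq_iff)
    fix a :: "nat \<Rightarrow> real"
    assume "summable (\<lambda>n. (a (Suc n))\<^sup>2 * log 2 (real (Suc n)))"
    then have "AE x in unit_leb. summable (\<lambda>n. a (Suc n) * g (\<sigma> (Suc n)) x)"
      by (rule AE_summable_rearrangement[OF inj])
    \<comment> \<open>The bijection takes the value 1 exactly once, so the series for
      \<open>g\<close> and \<open>h\<close> agree from some term on and converge at the same
      points.\<close>
    moreover have "\<forall>\<^sub>F n in sequentially. \<sigma> (Suc n) \<noteq> 1"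
    proof -
      obtain k where "1 \<le> k" "\<sigma> k = 1"
        using assms(2) unfolding bij_betw_def by (metis atLeast_iff imageE order_refl)
      then have "\<sigma> (Suc n) \<noteq> 1" if "n \<ge> k" for n
        using inj_onD[OF bij_betw_imp_inj_on[OF assms(2)], of "Suc n" k] that by auto
      then show ?thesis unfolding eventually_sequentially by blast
    qed
    then have "\<forall>\<^sub>F n in sequentially. a (Suc n) * g (\<sigma> (Suc n)) x = a (Suc n) * h (\<sigma> (Suc n)) x" for x
    proof eventually_elim
      case (elim n)
      with \<sigma>[of "Suc n"] show ?case by (simp add: g_def)
    qed
    then have "summable (\<lambda>n. a (Suc n) * g (\<sigma> (Suc n)) x)
        = summable (\<lambda>n. a (Suc n) * h (\<sigma> (Suc n)) x)" for x
      by (rule summable_cong)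
    ultimately show "AE x in unit_leb. summable (\<lambda>n. a (Suc n) * h (\<sigma> (Suc n)) x)" by simp
  qed
qed

end
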